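(* Let $H$ be a subgroup of a finite nilpotent group $G$. If $|[G, H]| = p$, where $p$ is a prime (not necessarily the smallest prime dividing $|G|$), and $g \in [G, H]$, then \[ {\Pr}_g(H, G) = \begin{cases} \frac{1}{p}\left(1 + \frac{p - 1}{|H : Z(H, G)|}\right) & \text{if } g = 1,\\ \frac{1}{p}\left(1 - \frac{1}{|H : Z(H, G)|}\right) & \text{if } g \ne 1. \end{cases} \]
   Context: For a finite group $G$ and a subgroup $H$ of $G$: $[x,y] := xyx^{-1}y^{-1}$; $[G,H]$ is the subgroup of $G$ generated by $\{[x,y] : x \in G,\ y\in H\}$; $Z(H,G) := \{h \in H : hg = gh \text{ for all } g \in G\} = Z(G)\cap H$. For $g \in G$, \[ {\Pr}_g(H,G) := \frac{|\{(x,y)\in H\times G : xyx^{-1}y^{-1} = g\}|}{|H||G|}. \] *)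

theory Defs
  imports Complex_Main "HOL-Algebra.Generated_Groups" "HOL-Computational_Algebra.Primes"
begin

definition commutator :: "('a, 'b) monoid_scheme \<Rightarrow> 'a \<Rightarrow> 'a \<Rightarrow> 'a" where
  "commutator G x y = x \<otimes>\<^bsub>G\<^esub> y \<otimes>\<^bsub>G\<^esub> inv\<^bsub>G\<^esub> x \<otimes>\<^bsub>G\<^esub> inv\<^bsub>G\<^esub> y"

definition commutator_subgroup :: "('a, 'b) monoid_scheme \<Rightarrow> 'a set \<Rightarrow> 'a set \<Rightarrow> 'a set" where
  "commutator_subgroup G K H = generate G {commutator G x y | x y. x \<in> K \<and> y \<in> H}"

primrec lower_central :: "('a, 'b) monoid_scheme \<Rightarrow> nat \<Rightarrow> 'a set" where
  "lower_central G 0 = carrier G"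
| "lower_central G (Suc n) = commutator_subgroup G (carrier G) (lower_central G n)"

definition nilpotent_group :: "('a, 'b) monoid_scheme \<Rightarrow> bool" where
  "nilpotent_group G \<longleftrightarrow> group G \<and> (\<exists>n. lower_central G n = {\<one>\<^bsub>G\<^esub>})"

definition rel_center :: "'a set \<Rightarrow> ('a, 'b) monoid_scheme \<Rightarrow> 'a set" where
  "rel_center H G = {h \<in> H. \<forall>g \<in> carrier G. h \<otimes>\<^bsub>G\<^esub> g = g \<otimes>\<^bsub>G\<^esub> h}"

text \<open>The index of \<open>K\<close> in \<open>H\<close>, where both are subgroups of \<open>G\<close>: the number of right cosets
  of \<open>K\<close> inside the group \<open>H\<close>.\<close>

definition subgroup_index :: "('a, 'b) monoid_scheme \<Rightarrow> 'a set \<Rightarrow> 'a set \<Rightarrow> nat" where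
  "subgroup_index G H K = card (rcosets\<^bsub>G\<lparr>carrier := H\<rparr>\<^esub> K)"

definition commutator_prob :: "'a \<Rightarrow> 'a set \<Rightarrow> ('a, 'b) monoid_scheme \<Rightarrow> real" where
  "commutator_prob g H G =
     real (card {(x, y). x \<in> H \<and> y \<in> carrier G \<and> commutator G x y = g})
       / (real (card H) * real (card (carrier G)))"

end

theory Submission
  imports Defs
begin

text \<open>
  Write \<open>K = [G,H]\<close>. Since \<open>[x y, h] = x [y, h] x\<inverse> [x, h]\<close>, the subgroup \<open>K\<close> is normal,
  so \<open>[G,K]\<close> is a subgroup of the group \<open>K\<close> of prime order and is either trivial or all of \<open>K\<close>.
  If \<open>[G,K] = K\<close>, then \<open>K\<close> lies in every term of the lower central series, which contradicts
  nilpotency; hence \<open>K\<close> is central (\<open>normal_prime_order_central\<close>). This is the only place where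
  nilpotency enters.

  Because \<open>K\<close> is central, for each fixed \<open>x \<in> H\<close> the map \<open>y \<mapsto> [x, y]\<close> is a homomorphism from
  \<open>G\<close> into \<open>K\<close> (\<open>commutator_hom\<close>). Its image is trivial when \<open>x \<in> Z(H,G)\<close>, and otherwise,
  again because \<open>|K|\<close> is prime, it is all of \<open>K\<close>. The fibres of a homomorphism over its image
  all have the same size (\<open>card_fibre_hom\<close>), so \<open>x \<notin> Z(H,G)\<close> contributes \<open>|G| / p\<close> solutions
  of \<open>[x, y] = g\<close> whatever \<open>g\<close> is, whereas \<open>x \<in> Z(H,G)\<close> contributes \<open>|G|\<close> solutions for
  \<open>g = 1\<close> and none for \<open>g \<noteq> 1\<close>. Summing over \<open>x\<close> and writing \<open>|H| = |H : Z(H,G)| |Z(H,G)|\<close> gives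
  the formula.
\<close>

section \<open>Commutator identities and commutator subgroups\<close>

context group
begin

lemma inv_mult_cancel_left:
  assumes "x \<in> carrier G" "z \<in> carrier G"
  shows "inv x \<otimes> (x \<otimes> z) = z" "x \<otimes> (inv x \<otimes> z) = z"
  using assms by (simp_all flip: m_assoc)

lemma commutator_closed:
  assumes "x \<in> carrier G" "y \<in> carrier G"
  shows "commutator G x y \<in> carrier G"
  using assms by (simp add: commutator_def)

lemma inv_commutator:
  assumes "x \<in> carrier G" "y \<in> carrier G"
  shows "inv (commutator G x y) = commutator G y x"
  using assms by (simp add: commutator_def inv_mult_group m_assoc)

lemma commutator_mult_left:
  assumes "x \<in> carrier G" "y \<in> carrier G" "h \<in> carrier G"
  shows "commutator G (x \<otimes> y) h = x \<otimes> commutator G y h \<otimes> inv x \<otimes> commutator G x h"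
  using assms by (simp add: commutator_def inv_mult_group m_assoc inv_mult_cancel_left)

lemma commutator_mult_right:
  assumes "x \<in> carrier G" "y \<in> carrier G" "z \<in> carrier G"
  shows "commutator G x (y \<otimes> z) = commutator G x y \<otimes> (y \<otimes> commutator G x z \<otimes> inv y)"
  using assms by (simp add: commutator_def inv_mult_group m_assoc inv_mult_cancel_left)

lemma commutator_eq_one_iff:
  assumes "x \<in> carrier G" "y \<in> carrier G"
  shows "commutator G x y = \<one> \<longleftrightarrow> x \<otimes> y = y \<otimes> x"
proof -
  have "commutator G x y \<otimes> (y \<otimes> x) = x \<otimes> y"
    using assms by (simp add: commutator_def m_assoc inv_mult_cancel_left)
  then show ?thesis
    using right_cancel[of "y \<otimes> x" "commutator G x y" \<one>] assms commutator_closed[OF assms]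
    by simp
qed

lemma commutator_subgroup_is_subgroup:
  assumes "A \<subseteq> carrier G" "B \<subseteq> carrier G"
  shows "subgroup (commutator_subgroup G A B) G"
  unfolding commutator_subgroup_def
  by (rule generate_is_subgroup) (use assms commutator_closed in blast)

lemma commutator_in_commutator_subgroup:
  assumes "x \<in> A" "y \<in> B"
  shows "commutator G x y \<in> commutator_subgroup G A B"
  unfolding commutator_subgroup_def using assms by (intro generate.incl) blast

lemma commutator_subgroup_mono:
  assumes "B \<subseteq> C"
  shows "commutator_subgroup G A B \<subseteq> commutator_subgroup G A C"
  unfolding commutator_subgroup_def by (rule mono_generate) (use assms in blast)

text \<open>The set of commutators need not be closed under conjugation when \<open>H\<close> is not normal, but the
  conjugate \<open>x [y, h] x\<inverse> = [x y, h] [x, h]\<inverse>\<close> of a generator is still a product of two elements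
  of the commutator subgroup.\<close>

lemma commutator_subgroup_conj_closed:
  assumes H: "H \<subseteq> carrier G" and x: "x \<in> carrier G"
    and k: "k \<in> commutator_subgroup G (carrier G) H"
  shows "x \<otimes> k \<otimes> inv x \<in> commutator_subgroup G (carrier G) H" (is "_ \<in> ?K")
proof -
  interpret K: subgroup ?K G
    using commutator_subgroup_is_subgroup[OF subset_refl H] .
  let ?S = "{commutator G y h | y h. y \<in> carrier G \<and> h \<in> H}"
  have gen: "x \<otimes> s \<otimes> inv x \<in> ?K" if "s \<in> ?S" for s
  proof -
    from that obtain y h where yh: "y \<in> carrier G" "h \<in> H" "s = commutator G y h" by blast
    with H have h: "h \<in> carrier G" by blast
    have "x \<otimes> s \<otimes> inv x = commutator G (x \<otimes> y) h \<otimes> inv (commutator G x h)"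
      using x yh h commutator_closed by (simp add: commutator_mult_left m_assoc)
    also have "\<dots> \<in> ?K"
      using x yh by (intro K.m_closed K.m_inv_closed commutator_in_commutator_subgroup) auto
    finally show ?thesis .
  qed
  have S: "?S \<subseteq> carrier G" using H commutator_closed by blast
  from k have "k \<in> generate G ?S" by (simp add: commutator_subgroup_def)
  then show ?thesis
  proof induction
    case one
    then show ?case using x by simp
  next
    case (incl s)
    then show ?case by (rule gen)
  next
    case (inv s)
    then have "s \<in> carrier G" using S by blast
    then have "x \<otimes> inv s \<otimes> inv x = inv (x \<otimes> s \<otimes> inv x)"
      using x by (simp add: inv_mult_group m_assoc)
    then show ?case using K.m_inv_closed[OF gen[OF inv]] by simp
  next
    case (eng a b)
    then have "a \<in> carrier G" "b \<in> carrier G"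
      using generate_in_carrier[OF S] by blast+
    then have "x \<otimes> (a \<otimes> b) \<otimes> inv x = (x \<otimes> a \<otimes> inv x) \<otimes> (x \<otimes> b \<otimes> inv x)"
      using x by (simp add: m_assoc inv_mult_cancel_left)
    then show ?case using K.m_closed[OF eng.IH] by simp
  qed
qed

section \<open>Centrality of a normal subgroup of prime order\<close>

lemma subgroup_of_prime_card:
  assumes "subgroup K G" "Factorial_Ring.prime (card K)" "subgroup I G" "I \<subseteq> K"
  shows "I = {\<one>} \<or> I = K"
proof -
  have fin: "finite K"
    using assms(2) by (metis card.infinite not_prime_0)
  have "card I dvd card K"
    using group.lagrange[OF subgroup.subgroup_is_group[OF assms(1) is_group]
        subgroup_incl[OF assms(3,1,4)]]
    by (simp add: order_def) (metis dvd_triv_right)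
  then have "card I = 1 \<or> card I = card K"
    using assms(2) by (auto simp: prime_nat_iff)
  then show ?thesis
    using subgroup.one_closed[OF assms(3)] card_subset_eq[OF fin assms(4)]
    by (auto simp: card_1_singleton_iff)
qed

text \<open>If \<open>[G,K]\<close> were not trivial it would equal \<open>K\<close>, and then \<open>K = [G,K]\<close> could never leave the
  lower central series.\<close>

lemma normal_prime_order_central:
  assumes "nilpotent_group G" and K: "subgroup K G" and p: "Factorial_Ring.prime (card K)"
    and conj: "\<And>x k. x \<in> carrier G \<Longrightarrow> k \<in> K \<Longrightarrow> x \<otimes> k \<otimes> inv x \<in> K"
    and x: "x \<in> carrier G" and k: "k \<in> K"
  shows "x \<otimes> k = k \<otimes> x"
proof -
  let ?C = "commutator_subgroup G (carrier G) K"
  have KG: "K \<subseteq> carrier G" using K by (rule subgroup.subset)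
  have C: "subgroup ?C G"
    using commutator_subgroup_is_subgroup[OF subset_refl KG] .
  have "?C \<subseteq> K"
    unfolding commutator_subgroup_def
  proof (rule generate_subgroup_incl[OF _ K], safe)
    fix y h assume "y \<in> carrier G" "h \<in> K"
    then show "commutator G y h \<in> K"
      using conj K unfolding commutator_def by (auto intro: subgroup.m_closed subgroup.m_inv_closed)
  qed
  then have "?C = {\<one>} \<or> ?C = K"
    by (rule subgroup_of_prime_card[OF K p C])
  moreover have "?C \<noteq> K"
  proof
    assume eq: "?C = K"
    have "K \<subseteq> lower_central G n" for n
    proof (induction n)
      case (Suc n)
      then show ?case
        using commutator_subgroup_mono[OF Suc, of "carrier G"] eq by simp
    qed (use KG in simp)
    then have "K \<subseteq> {\<one>}"
      using assms(1) unfolding nilpotent_group_def by metis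
    then have "card K \<le> 1"
      using card_mono[of "{\<one>}" K] by simp
    then show False using prime_gt_1_nat[OF p] by simp
  qed
  ultimately have "commutator G x k = \<one>"
    using commutator_in_commutator_subgroup[OF x k] by auto
  then show ?thesis
    using commutator_eq_one_iff x k KG by blast
qed

text \<open>In \<open>[x, y z] = [x, y] (y [x, z] y\<inverse>)\<close> the conjugation disappears when commutators with
  \<open>x\<close> are central.\<close>

lemma commutator_hom:
  assumes x: "x \<in> carrier G"
    and central: "\<And>y z. y \<in> carrier G \<Longrightarrow> z \<in> carrier G \<Longrightarrow>
        y \<otimes> commutator G x z = commutator G x z \<otimes> y"
  shows "commutator G x \<in> hom G G"
proof (rule homI)
  fix y z assume yz: "y \<in> carrier G" "z \<in> carrier G"
  then have "y \<otimes> commutator G x z \<otimes> inv y = commutator G x z"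
    using commutator_closed[OF x yz(2)] by (simp add: central[OF yz]) (simp add: m_assoc)
  with x yz show "commutator G x (y \<otimes> z) = commutator G x y \<otimes> commutator G x z"
    by (simp add: commutator_mult_right)
qed (use x commutator_closed in blast)

end

section \<open>Fibres of homomorphisms and the relative centre\<close>

text \<open>Left translation by a preimage of \<open>h\<close> carries the kernel onto the fibre over \<open>h\<close>, so the
  fibres partition the domain into parts of equal size.\<close>

lemma (in group_hom) card_fibre_hom:
  assumes fin: "finite (carrier G)" and k: "k \<in> h ` carrier G"
  shows "card (h ` carrier G) * card {y \<in> carrier G. h y = k} = card (carrier G)"
proof -
  have fibre: "card {y \<in> carrier G. h y = l} = card (kernel G H h)"
    if l: "l \<in> h ` carrier G" for l
  proof -
    from l obtain t where t: "t \<in> carrier G" "l = h t" by blast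
    have "bij_betw (\<lambda>y. t \<otimes> y) (kernel G H h) {y \<in> carrier G. h y = l}"
      by (rule bij_betw_byWitness[where f' = "\<lambda>y. inv t \<otimes> y"])
        (use t in \<open>auto simp: kernel_def G.inv_mult_cancel_left\<close>)
    then show ?thesis by (simp add: bij_betw_same_card)
  qed
  have "card (carrier G) = (\<Sum>l\<in>h ` carrier G. card {y \<in> carrier G. h y = l})"
    using sum.image_gen[OF fin, of "\<lambda>_. 1::nat" h] by simp
  also have "\<dots> = card (h ` carrier G) * card (kernel G H h)"
    using fibre by simp
  finally show ?thesis using fibre[OF k] by simp
qed

lemma (in group) rel_center_subgroup:
  assumes "subgroup H G"
  shows "subgroup (rel_center H G) G"
proof -
  interpret H: subgroup H G by fact
  show ?thesis
  proof (rule subgroupI)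
    show "rel_center H G \<subseteq> carrier G"
      using H.subset by (auto simp: rel_center_def)
    show "rel_center H G \<noteq> {}"
      using H.one_closed by (auto simp: rel_center_def intro!: exI[of _ \<one>])
  next
    fix a assume a: "a \<in> rel_center H G"
    then have aG: "a \<in> carrier G" by (auto simp: rel_center_def)
    show "inv a \<in> rel_center H G"
      unfolding rel_center_def
    proof (intro CollectI conjI ballI)
      show "inv a \<in> H" using a by (auto simp: rel_center_def)
      fix y assume y: "y \<in> carrier G"
      then have "a \<otimes> inv y = inv y \<otimes> a"
        using a by (simp only: rel_center_def mem_Collect_eq inv_closed)
      then have "inv (inv y \<otimes> a) = inv (a \<otimes> inv y)"
        by (rule arg_cong[OF sym])
      then show "inv a \<otimes> y = y \<otimes> inv a"
        using aG y by (simp add: inv_mult_group)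
    qed
  next
    fix a b assume ab: "a \<in> rel_center H G" "b \<in> rel_center H G"
    then have H: "a \<in> H" "b \<in> H" by (simp_all only: rel_center_def mem_Collect_eq)
    then have G: "a \<in> carrier G" "b \<in> carrier G" by simp_all
    show "a \<otimes> b \<in> rel_center H G"
      unfolding rel_center_def
    proof (intro CollectI conjI ballI)
      show "a \<otimes> b \<in> H" using H by simp
      fix y assume y: "y \<in> carrier G"
      then have comm: "a \<otimes> y = y \<otimes> a" "b \<otimes> y = y \<otimes> b"
        using ab by (simp_all only: rel_center_def mem_Collect_eq)
      have "a \<otimes> b \<otimes> y = a \<otimes> y \<otimes> b"
        using G y by (simp only: m_assoc comm(2))
      also have "\<dots> = y \<otimes> (a \<otimes> b)"
        using G y by (simp only: comm(1)) (simp only: m_assoc)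
      finally show "a \<otimes> b \<otimes> y = y \<otimes> (a \<otimes> b)" .
    qed
  qed
qed

lemma (in group) subgroup_index_mult_card:
  assumes "subgroup H G" "subgroup K G" "K \<subseteq> H"
  shows "subgroup_index G H K * card K = card H"
  using group.lagrange[OF subgroup.subgroup_is_group[OF assms(1) is_group]
      subgroup_incl[OF assms(2,1,3)]]
  by (simp add: subgroup_index_def order_def)

section \<open>The commutator probability\<close>

theorem theoremB:
  fixes G :: "('a, 'b) monoid_scheme" and H :: "'a set" and g :: 'a and p :: nat
  assumes "group G" and "finite (carrier G)" and "nilpotent_group G"
    and "subgroup H G"
    and "Factorial_Ring.prime p"
    and "card (commutator_subgroup G (carrier G) H) = p"
    and "g \<in> commutator_subgroup G (carrier G) H"
  shows "commutator_prob g H G =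
    (if g = \<one>\<^bsub>G\<^esub>
     then 1 / real p * (1 + (real p - 1) / real (subgroup_index G H (rel_center H G)))
     else 1 / real p * (1 - 1 / real (subgroup_index G H (rel_center H G))))"
proof -
  interpret group G by fact
  interpret H: subgroup H G by fact
  define K where "K = commutator_subgroup G (carrier G) H"
  define Z where "Z = rel_center H G"
  define i where "i = subgroup_index G H Z"
  define N where "N x = card {y \<in> carrier G. commutator G x y = g}" for x
  have K: "subgroup K G"
    unfolding K_def by (rule commutator_subgroup_is_subgroup[OF subset_refl H.subset])
  have cardK: "card K = p" and gK: "g \<in> K"
    using assms(6,7) by (simp_all add: K_def)
  have primeK: "Factorial_Ring.prime (card K)"
    using cardK assms(5) by simp
  have central: "x \<otimes>\<^bsub>G\<^esub> k = k \<otimes>\<^bsub>G\<^esub> x" if "x \<in> carrier G" "k \<in> K" for x k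
    using normal_prime_order_central[OF assms(3) K primeK _ that]
      commutator_subgroup_conj_closed[OF H.subset] unfolding K_def by blast
  have comm_K: "commutator G x y \<in> K" if "x \<in> H" "y \<in> carrier G" for x y
  proof -
    \<comment> \<open>\<open>K\<close> is generated by commutators whose entry from \<open>H\<close> comes second, so the order must be reversed.\<close>
    have "commutator G x y = inv\<^bsub>G\<^esub> (commutator G y x)"
      using that by (simp add: inv_commutator)
    then show ?thesis
      using subgroup.m_inv_closed[OF K] commutator_in_commutator_subgroup[OF that(2,1)]
      by (simp add: K_def)
  qed
  have ZH: "Z \<subseteq> H" by (auto simp: Z_def rel_center_def)
  have Z: "x \<in> Z \<longleftrightarrow> (\<forall>y\<in>carrier G. commutator G x y = \<one>\<^bsub>G\<^esub>)" if "x \<in> H" for x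
    using that by (auto simp: Z_def rel_center_def commutator_eq_one_iff)
  have NZ: "N x = (if g = \<one>\<^bsub>G\<^esub> then card (carrier G) else 0)" if "x \<in> Z" for x
  proof -
    have "{y \<in> carrier G. commutator G x y = g} = (if g = \<one>\<^bsub>G\<^esub> then carrier G else {})"
      using Z[of x] that ZH by auto
    then show ?thesis by (simp add: N_def)
  qed
  have NnZ: "p * N x = card (carrier G)" if x: "x \<in> H - Z" for x
  proof -
    have "commutator G x \<in> hom G G"
      by (rule commutator_hom) (use x comm_K central in auto)
    then interpret c: group_hom G G "commutator G x"
      by unfold_locales
    have "commutator G x ` carrier G \<subseteq> K"
      using x comm_K by blast
    moreover have "commutator G x ` carrier G \<noteq> {\<one>\<^bsub>G\<^esub>}"
      using x Z[of x] by blast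
    ultimately have "commutator G x ` carrier G = K"
      using subgroup_of_prime_card[OF K primeK c.img_is_subgroup] by blast
    then show ?thesis
      using c.card_fibre_hom[OF assms(2)] gK cardK by (simp add: N_def)
  qed
  have finH: "finite H" using assms(2) H.subset finite_subset by blast
  have pos: "0 < p" "0 < card H" "0 < card (carrier G)" "0 < card Z"
    using prime_gt_0_nat[OF assms(5)] finH assms(2) H.one_closed ZH
      subgroup.one_closed[OF rel_center_subgroup[OF assms(4)]] finite_subset[OF ZH finH]
    by (auto simp: card_gt_0_iff Z_def)
  have index: "i * card Z = card H"
    unfolding i_def Z_def
    by (rule subgroup_index_mult_card[OF assms(4) rel_center_subgroup[OF assms(4)]])
      (use ZH Z_def in blast)
  have "{(x, y). x \<in> H \<and> y \<in> carrier G \<and> commutator G x y = g}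
      = (SIGMA x:H. {y \<in> carrier G. commutator G x y = g})"
    by auto
  then have "card {(x, y). x \<in> H \<and> y \<in> carrier G \<and> commutator G x y = g} = (\<Sum>x\<in>H. N x)"
    using finH assms(2) by (simp add: N_def)
  also have "\<dots> = (\<Sum>x\<in>Z. N x) + (\<Sum>x\<in>H - Z. N x)"
    using sum.subset_diff[OF ZH finH, of N] by simp
  finally have "real (card {(x, y). x \<in> H \<and> y \<in> carrier G \<and> commutator G x y = g})
      = (\<Sum>x\<in>Z. real (N x)) + (\<Sum>x\<in>H - Z. real (N x))"
    by simp
  also have "(\<Sum>x\<in>Z. real (N x)) = real (card Z) * (if g = \<one>\<^bsub>G\<^esub> then card (carrier G) else 0)"
    using NZ by simp
  also have "(\<Sum>x\<in>H - Z. real (N x)) = (\<Sum>x\<in>H - Z. real (card (carrier G)) / real p)"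
    using NnZ pos by (intro sum.cong) (auto simp: field_simps simp flip: of_nat_mult)
  also have "\<dots> = (real (card H) - real (card Z)) * (real (card (carrier G)) / real p)"
    using card_Diff_subset[OF finite_subset[OF ZH finH] ZH] card_mono[OF finH ZH]
    by simp
  finally have count: "real (card {(x, y). x \<in> H \<and> y \<in> carrier G \<and> commutator G x y = g})
      = real (card Z) * (if g = \<one>\<^bsub>G\<^esub> then card (carrier G) else 0)
        + (real (card H) - real (card Z)) * (real (card (carrier G)) / real p)" .
  have H_eq: "real (card H) = real i * real (card Z)"
    using index by (simp flip: of_nat_mult)
  have ipos: "0 < i" using index pos by (cases i) auto
  show ?thesis
    unfolding commutator_prob_def count
    unfolding Z_def[symmetric] i_def[symmetric] H_eq
    using pos ipos by (simp add: field_simps)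
qed

end
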